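(* Let $X,Y$ be metric spaces, let $f:X\to Y$ be a quasi-isometric embedding, and let $s:\mathbb{R}^+\to\mathbb{N}$ be a decomposition complexity growth function for $Y$. Then there is a function $t:\mathbb{R}^+\to\mathbb{N}$ such that $s\sim t$ and $t$ is a decomposition complexity growth function for $X$. Hence the existence of a decomposition complexity growth function of a given growth type is a quasi-isometry invariant: if $X$ and $Y$ are quasi-isometric metric spaces and $s$ is a decomposition complexity growth function for one of them, then the other has a decomposition complexity growth function $t$ with $t\sim s$.
   Context: $\mathbb{R}^+$ denotes the positive reals. A map $f:X\to Y$ of metric spaces is a quasi-isometric embedding if there are constants $L,C>0$ such that $\frac1L d(x,y)-C<d(f(x),f(y))<L\,d(x,y)+C$ for all $x,y\in X$. A quasi-isometry is a quasi-isometric embedding $f:X\to Y$ for which there is $C>0$ such that every $y\in Y$ has some $x\in X$ with $d(y,f(x))<C$; $X$ and $Y$ are quasi-isometric if there is a quasi-isometry $X\to Y$. For nonempty subsets $A,B$ of a metric space, $d(A,B)=\inf\{d(a,b):a\in A,b\in B\}$. For $R>0$, a family $\mathcal{U}$ of nonempty subsets of a metric space is $R$-disjoint if $d(A,B)>R$ for all $A,B\in\mathcal{U}$ with $A\neq B$. A metric family is a family of metric spaces (subsets of a metric space carry the restricted metric); it is uniformly bounded if the supremum of the diameters of its members is finite. A metric space $X$ $(R,n)$-decomposes over a metric family $\mathcal{V}$, written $X\stackrel{R,n}{\longrightarrow}\mathcal{V}$, if there is a family $\mathcal{U}=\mathcal{U}_1\cup\dots\cup\mathcal{U}_n$ of subsets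 of $X$ covering $X$ such that each $\mathcal{U}_i$ is $R$-disjoint and $\mathcal{U}\subset\mathcal{V}$. For metric families, $\mathcal{U}\stackrel{R,n}{\longrightarrow}\mathcal{V}$ means that every member of $\mathcal{U}$ $(R,n)$-decomposes over $\mathcal{V}$. A non-decreasing function $s:\mathbb{R}^+\to\mathbb{N}$ is a decomposition complexity growth function for a metric space $X$ if for every sequence $R_1\le R_2\le R_3\le\cdots$ of positive reals there exist a positive integer $n$ and metric families $\mathcal{V}_1,\dots,\mathcal{V}_n$ with $$X\stackrel{R_1,s(R_1)}{\longrightarrow}\mathcal{V}_1\stackrel{R_2,s(R_2)}{\longrightarrow}\mathcal{V}_2\stackrel{R_3,s(R_3)}{\longrightarrow}\cdots\stackrel{R_n,s(R_n)}{\longrightarrow}\mathcal{V}_n$$ and $\mathcal{V}_n$ uniformly bounded. Non-decreasing functions $s,t:\mathbb{R}^+\to\mathbb{N}$ have the same growth, written $s\sim t$, if there are constants $a,c>0$ such that $s(ax)\ge t(x)-c$ and $t(ax)\ge s(x)-c$ for all $x>0$. *)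

theory Defs
  imports "HOL-Analysis.Analysis"
begin

text \<open>Metric spaces are elements of the type \<open>'a metric\<close>; they may be empty. A subset \<open>A\<close> of a metric
  space \<open>X\<close> with the restricted metric is \<open>submetric X A\<close>.\<close>

definition qi_embedding :: "'a metric \<Rightarrow> 'b metric \<Rightarrow> ('a \<Rightarrow> 'b) \<Rightarrow> bool" where
  "qi_embedding X Y f \<longleftrightarrow>
     f \<in> mspace X \<rightarrow> mspace Y \<and>
     (\<exists>L C. 0 < L \<and> 0 < C \<and>
       (\<forall>x\<in>mspace X. \<forall>y\<in>mspace X.
          1 / L * mdist X x y - C < mdist Y (f x) (f y) \<and>
          mdist Y (f x) (f y) < L * mdist X x y + C))"

definition quasi_isometry :: "'a metric \<Rightarrow> 'b metric \<Rightarrow> ('a \<Rightarrow> 'b) \<Rightarrow> bool" where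
  "quasi_isometry X Y f \<longleftrightarrow>
     qi_embedding X Y f \<and>
     (\<exists>C>0. \<forall>y\<in>mspace Y. \<exists>x\<in>mspace X. mdist Y y (f x) < C)"

definition quasi_isometric :: "'a metric \<Rightarrow> 'b metric \<Rightarrow> bool" where
  "quasi_isometric X Y \<longleftrightarrow> (\<exists>f. quasi_isometry X Y f)"

text \<open>Only meaningful for nonempty \<open>A\<close> and \<open>B\<close>.\<close>

definition mset_dist :: "'a metric \<Rightarrow> 'a set \<Rightarrow> 'a set \<Rightarrow> real" where
  "mset_dist X A B = Inf {mdist X a b | a b. a \<in> A \<and> b \<in> B}"

definition R_disjoint :: "'a metric \<Rightarrow> real \<Rightarrow> 'a set set \<Rightarrow> bool" where
  "R_disjoint X R \<U> \<longleftrightarrow>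
     (\<forall>A\<in>\<U>. A \<noteq> {} \<and> A \<subseteq> mspace X) \<and>
     (\<forall>A\<in>\<U>. \<forall>B\<in>\<U>. A \<noteq> B \<longrightarrow> mset_dist X A B > R)"

definition mdiameter :: "'a metric \<Rightarrow> ennreal" where
  "mdiameter X = (SUP (x, y)\<in>mspace X \<times> mspace X. ennreal (mdist X x y))"

text \<open>A metric family is a set of metric spaces. Its members need not be subspaces of one ambient
  space, but they share a carrier type; this costs no generality below, because only those members
  that are subspaces of the space being decomposed are ever used.\<close>

definition uniformly_bounded :: "'a metric set \<Rightarrow> bool" where
  "uniformly_bounded \<V> \<longleftrightarrow> (SUP Z\<in>\<V>. mdiameter Z) < \<infinity>"

definition decomposes_over :: "'a metric \<Rightarrow> real \<Rightarrow> nat \<Rightarrow> 'a metric set \<Rightarrow> bool" where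
  "decomposes_over X R n \<V> \<longleftrightarrow>
     (\<exists>\<U> :: nat \<Rightarrow> 'a set set.
        (\<forall>i\<in>{1..n}. R_disjoint X R (\<U> i)) \<and>
        \<Union> (\<Union>i\<in>{1..n}. \<U> i) = mspace X \<and>
        submetric X ` (\<Union>i\<in>{1..n}. \<U> i) \<subseteq> \<V>)"

definition family_decomposes_over :: "'a metric set \<Rightarrow> real \<Rightarrow> nat \<Rightarrow> 'a metric set \<Rightarrow> bool" where
  "family_decomposes_over \<W> R n \<V> \<longleftrightarrow> (\<forall>X\<in>\<W>. decomposes_over X R n \<V>)"

text \<open>Functions on the positive reals are represented by functions on \<open>real\<close> whose values outside
  \<open>{0<..}\<close> are irrelevant; sequences are indexed from 1, and their value at 0 is irrelevant.\<close>

definition dc_growth_function :: "'a metric \<Rightarrow> (real \<Rightarrow> nat) \<Rightarrow> bool" where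
  "dc_growth_function X s \<longleftrightarrow>
     mono_on {0<..} s \<and>
     (\<forall>R :: nat \<Rightarrow> real.
        (\<forall>i\<ge>1. 0 < R i \<and> R i \<le> R (Suc i)) \<longrightarrow>
        (\<exists>n\<ge>1. \<exists>\<V> :: nat \<Rightarrow> 'a metric set.
           decomposes_over X (R 1) (s (R 1)) (\<V> 1) \<and>
           (\<forall>i\<in>{1..<n}.
              family_decomposes_over (\<V> i) (R (Suc i)) (s (R (Suc i))) (\<V> (Suc i))) \<and>
           uniformly_bounded (\<V> n)))"

text \<open>Applied only to functions that are non-decreasing on the positive reals.\<close>

definition same_growth :: "(real \<Rightarrow> nat) \<Rightarrow> (real \<Rightarrow> nat) \<Rightarrow> bool" where
  "same_growth s t \<longleftrightarrow>
     (\<exists>a c :: real. 0 < a \<and> 0 < c \<and>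
       (\<forall>x>0. real (s (a * x)) \<ge> real (t x) - c \<and> real (t (a * x)) \<ge> real (s x) - c))"

end

theory Submission
  imports Defs
begin

text \<open>A quasi-isometric embedding \<open>f\<close> with constants \<open>L, C\<close> pulls an \<open>(L R + C)\<close>-disjoint family back
  to an \<open>R\<close>-disjoint one and a bounded set back to a bounded one, so decomposing \<open>Y\<close> along the
  sequence \<open>L R\<^sub>i + C\<close> decomposes \<open>X\<close> along \<open>R\<^sub>i\<close>. Hence \<open>t x = s (L x + C)\<close> works for \<open>X\<close>; it has
  the growth of \<open>s\<close> since \<open>L x + C \<le> (L + C) x\<close> for \<open>x \<ge> 1\<close>. The second claim
  follows because a quasi-isometry has a quasi-inverse, which is a quasi-isometric embedding.\<close>

section \<open>Preimages of metric families and of decompositions\<close>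

text \<open>Members of \<open>\<V>\<close> are arbitrary metrics on the carrier type; only those
  that are subspaces of \<open>Y\<close> have a preimage in \<open>X\<close>, hence the
  quantification over \<open>A\<close>.\<close>

definition pullback_family :: "'a metric \<Rightarrow> 'b metric \<Rightarrow> ('a \<Rightarrow> 'b) \<Rightarrow> 'b metric set \<Rightarrow> 'a metric set" where
  "pullback_family X Y f \<V> = {submetric X (f -` A) | A. A \<subseteq> mspace Y \<and> submetric Y A \<in> \<V>}"

lemma mset_dist_le:
  assumes "a \<in> A" "b \<in> B"
  shows "mset_dist X A B \<le> mdist X a b"
  unfolding mset_dist_def
  using assms by (intro cInf_lower) (auto intro!: bdd_belowI[where m = 0])

lemma mset_dist_greatest:
  assumes "A \<noteq> {}" "B \<noteq> {}" "\<And>a b. a \<in> A \<Longrightarrow> b \<in> B \<Longrightarrow> r \<le> mdist X a b"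
  shows "r \<le> mset_dist X A B"
  unfolding mset_dist_def using assms by (intro cInf_greatest) auto

lemma mset_dist_submetric [simp]: "mset_dist (submetric X S) A B = mset_dist X A B"
  by (simp add: mset_dist_def)

text \<open>Points whose images lie in different pieces have images more than
  \<open>L * R + C\<close> apart, so \<open>upper\<close> keeps the points themselves more than
  \<open>R\<close> apart. A general \<open>B\<close> in place of \<open>Y\<close> lets the same
  argument serve every stage of a chain of decompositions.\<close>

lemma decomposes_over_pullback:
  assumes f: "f \<in> mspace X \<rightarrow> mspace Y" and "0 < L"
    and upper: "\<And>x y. x \<in> mspace X \<Longrightarrow> y \<in> mspace X \<Longrightarrow> mdist Y (f x) (f y) \<le> L * mdist X x y + C"
    and dec: "decomposes_over (submetric Y B) (L * R + C) n \<V>"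
  shows "decomposes_over (submetric X (f -` B)) R n (pullback_family X Y f \<V>)"
proof -
  obtain \<U> where disj: "\<And>i. i \<in> {1..n} \<Longrightarrow> R_disjoint (submetric Y B) (L * R + C) (\<U> i)"
    and cover: "\<Union> (\<Union>i\<in>{1..n}. \<U> i) = B \<inter> mspace Y"
    and sub: "submetric (submetric Y B) ` (\<Union>i\<in>{1..n}. \<U> i) \<subseteq> \<V>"
    using dec unfolding decomposes_over_def mspace_submetric by metis
  \<comment> \<open>Pieces missed by \<open>f\<close> have empty preimage and are removed, since
    \<open>R_disjoint\<close> demands nonempty members; the union does not change.\<close>
  define \<W> where "\<W> i = (\<lambda>A. f -` A \<inter> mspace X) ` \<U> i - {{}}" for i
  have piece: "A \<subseteq> B \<inter> mspace Y" if "i \<in> {1..n}" "A \<in> \<U> i" for i A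
    using cover that by blast
  have "R_disjoint (submetric X (f -` B)) R (\<W> i)" if i: "i \<in> {1..n}" for i
    unfolding R_disjoint_def
  proof (intro conjI ballI impI)
    fix P Q assume PQ: "P \<in> \<W> i" "Q \<in> \<W> i" "P \<noteq> Q"
    then obtain A A' where A: "A \<in> \<U> i" "A' \<in> \<U> i" "P = f -` A \<inter> mspace X" "Q = f -` A' \<inter> mspace X"
      unfolding \<W>_def by auto
    have "L * R + C < mset_dist Y A A'"
      using disj[OF i] A PQ(3) unfolding R_disjoint_def mset_dist_submetric by blast
    \<comment> \<open>The strict inequality is secured before passing to the infimum: a pointwise
      bound \<open>R < mdist X a b\<close> alone would give only
      \<open>R \<le> mset_dist X P Q\<close>.\<close>
    then have "R < (mset_dist Y A A' - C) / L"
      using \<open>0 < L\<close> by (simp add: field_simps)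
    also have "\<dots> \<le> mset_dist X P Q"
    proof (rule mset_dist_greatest)
      fix a b assume ab: "a \<in> P" "b \<in> Q"
      then have "mset_dist Y A A' \<le> mdist Y (f a) (f b)"
        using A by (intro mset_dist_le) auto
      also have "\<dots> \<le> L * mdist X a b + C"
        using ab A by (intro upper) auto
      finally show "(mset_dist Y A A' - C) / L \<le> mdist X a b"
        using \<open>0 < L\<close> by (simp add: field_simps)
    qed (use PQ in \<open>auto simp: \<W>_def\<close>)
    finally show "R < mset_dist (submetric X (f -` B)) P Q" by simp
  qed (use piece[OF i] in \<open>auto simp: \<W>_def\<close>)
  moreover have "\<Union> (\<Union>i\<in>{1..n}. \<W> i) = mspace (submetric X (f -` B))"
  proof -
    have "\<Union> (\<Union>i\<in>{1..n}. \<W> i) = f -` \<Union> (\<Union>i\<in>{1..n}. \<U> i) \<inter> mspace X"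
      unfolding \<W>_def by blast
    then show ?thesis
      using f unfolding cover by auto
  qed
  moreover have "submetric (submetric X (f -` B)) ` (\<Union>i\<in>{1..n}. \<W> i) \<subseteq> pullback_family X Y f \<V>"
  proof (intro image_subsetI)
    fix P assume "P \<in> (\<Union>i\<in>{1..n}. \<W> i)"
    then obtain i A where A: "i \<in> {1..n}" "A \<in> \<U> i" "P = f -` A \<inter> mspace X"
      unfolding \<W>_def by blast
    have AB: "A \<subseteq> B" "A \<subseteq> mspace Y"
      using piece[OF A(1,2)] by auto
    have "submetric (submetric Y B) A \<in> \<V>"
      using sub A by blast
    then have "submetric Y A \<in> \<V>"
      using AB by (simp add: submetric_submetric Int_absorb1 Int_absorb2)
    \<comment> \<open>As \<open>A \<subseteq> B\<close>, the nested restriction collapses;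
      intersecting with \<open>mspace X\<close> is harmless because \<open>submetric\<close> does so
      anyway.\<close>
    moreover have "submetric (submetric X (f -` B)) P = submetric X (f -` A)"
    proof -
      have "f -` B \<inter> P = mspace X \<inter> f -` A"
        using AB A(3) by auto
      then show ?thesis
        by (metis submetric_restrict submetric_submetric)
    qed
    ultimately show "submetric (submetric X (f -` B)) P \<in> pullback_family X Y f \<V>"
      using AB unfolding pullback_family_def by auto
  qed
  ultimately show ?thesis
    unfolding decomposes_over_def by blast
qed

section \<open>Uniform boundedness\<close>

text \<open>Trades the \<open>ennreal\<close> supremum for a single real bound, which is easier to
  transport along \<open>f\<close>.\<close>

lemma uniformly_bounded_iff:
  "uniformly_bounded \<V> \<longleftrightarrow> (\<exists>D. \<forall>Z\<in>\<V>. \<forall>x\<in>mspace Z. \<forall>y\<in>mspace Z. mdist Z x y \<le> D)"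
proof
  assume bdd: "uniformly_bounded \<V>"
  define D where "D = (SUP Z\<in>\<V>. mdiameter Z)"
  have "mdist Z x y \<le> enn2real D" if "Z \<in> \<V>" "x \<in> mspace Z" "y \<in> mspace Z" for Z x y
  proof -
    have "ennreal (mdist Z x y) \<le> mdiameter Z"
      unfolding mdiameter_def using that by (intro SUP_upper2[where i = "(x, y)"]) auto
    also have "\<dots> \<le> D"
      unfolding D_def using that by (intro SUP_upper)
    \<comment> \<open>Finiteness of \<open>D\<close> matters here: \<open>enn2real\<close> sends
      infinity to 0 and is monotone only below a finite bound.\<close>
    finally have "enn2real (ennreal (mdist Z x y)) \<le> enn2real D"
      using bdd by (intro enn2real_mono) (auto simp: uniformly_bounded_def D_def)
    then show ?thesis by simp
  qed
  then show "\<exists>D. \<forall>Z\<in>\<V>. \<forall>x\<in>mspace Z. \<forall>y\<in>mspace Z. mdist Z x y \<le> D" by blast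
next
  assume "\<exists>D. \<forall>Z\<in>\<V>. \<forall>x\<in>mspace Z. \<forall>y\<in>mspace Z. mdist Z x y \<le> D"
  then obtain D where "\<forall>Z\<in>\<V>. \<forall>x\<in>mspace Z. \<forall>y\<in>mspace Z. mdist Z x y \<le> D" ..
  then have "(SUP Z\<in>\<V>. mdiameter Z) \<le> ennreal D"
    unfolding mdiameter_def by (intro SUP_least) (auto intro: ennreal_leI)
  then show "uniformly_bounded \<V>"
    unfolding uniformly_bounded_def by (simp add: order_le_less_trans)
qed

lemma uniformly_bounded_pullback:
  assumes f: "f \<in> mspace X \<rightarrow> mspace Y" and "0 < L"
    and lower: "\<And>x y. x \<in> mspace X \<Longrightarrow> y \<in> mspace X \<Longrightarrow> 1 / L * mdist X x y - C \<le> mdist Y (f x) (f y)"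
    and bdd: "uniformly_bounded \<V>"
  shows "uniformly_bounded (pullback_family X Y f \<V>)"
proof -
  obtain D where D: "\<And>Z x y. Z \<in> \<V> \<Longrightarrow> x \<in> mspace Z \<Longrightarrow> y \<in> mspace Z \<Longrightarrow> mdist Z x y \<le> D"
    using bdd unfolding uniformly_bounded_iff by blast
  have "mdist X x y \<le> L * (D + C)"
    if A: "submetric Y A \<in> \<V>" and xy: "x \<in> mspace X" "y \<in> mspace X" "f x \<in> A" "f y \<in> A" for A x y
  proof -
    have "mdist Y (f x) (f y) \<le> D"
      using D[OF A, of "f x" "f y"] xy f by auto
    then have "1 / L * mdist X x y \<le> D + C"
      using lower[OF xy(1,2)] by linarith
    then show ?thesis
      using \<open>0 < L\<close> by (simp add: field_simps)
  qed
  then show ?thesis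
    unfolding uniformly_bounded_iff pullback_family_def by (intro exI[of _ "L * (D + C)"]) auto
qed

lemma dc_growth_function_pullback:
  assumes f: "f \<in> mspace X \<rightarrow> mspace Y" and LC: "0 < L" "0 < C"
    and lower: "\<And>x y. x \<in> mspace X \<Longrightarrow> y \<in> mspace X \<Longrightarrow> 1 / L * mdist X x y - C \<le> mdist Y (f x) (f y)"
    and upper: "\<And>x y. x \<in> mspace X \<Longrightarrow> y \<in> mspace X \<Longrightarrow> mdist Y (f x) (f y) \<le> L * mdist X x y + C"
    and s: "dc_growth_function Y s"
  shows "dc_growth_function X (\<lambda>x. s (L * x + C))"
  unfolding dc_growth_function_def
proof (intro conjI allI impI)
  have "mono_on {0<..} s"
    using s by (simp add: dc_growth_function_def)
  then show "mono_on {0<..} (\<lambda>x. s (L * x + C))"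
    using LC by (auto simp: mono_on_def add_pos_pos)
next
  fix R :: "nat \<Rightarrow> real"
  \<comment> \<open>The rescaled sequence is again positive and non-decreasing, so the hypothesis on
    \<open>Y\<close> applies to it.\<close>
  assume "\<forall>i\<ge>1. 0 < R i \<and> R i \<le> R (Suc i)"
  then have "\<forall>i\<ge>1. 0 < L * R i + C \<and> L * R i + C \<le> L * R (Suc i) + C"
    using LC by (auto simp: add_pos_pos)
  then obtain n \<V> where n: "n \<ge> 1"
    and first: "decomposes_over Y (L * R 1 + C) (s (L * R 1 + C)) (\<V> 1)"
    and step: "\<And>i. i \<in> {1..<n} \<Longrightarrow>
      family_decomposes_over (\<V> i) (L * R (Suc i) + C) (s (L * R (Suc i) + C)) (\<V> (Suc i))"
    and bdd: "uniformly_bounded (\<V> n)"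
    using s unfolding dc_growth_function_def
    by (elim conjE allE[where x = "\<lambda>i. L * R i + C"]) blast
  let ?\<W> = "\<lambda>i. pullback_family X Y f (\<V> i)"
  have "decomposes_over (submetric X (f -` mspace Y)) (R 1) (s (L * R 1 + C)) (?\<W> 1)"
    using first by (intro decomposes_over_pullback[OF f \<open>0 < L\<close> upper]) auto
  moreover have "submetric X (f -` mspace Y) = X"
  proof -
    have "mspace X \<inter> f -` mspace Y = mspace X"
      using f by auto
    then show ?thesis
      by (metis submetric_mspace submetric_restrict)
  qed
  ultimately have "decomposes_over X (R 1) (s (L * R 1 + C)) (?\<W> 1)"
    by simp
  \<comment> \<open>Each member of \<open>?\<W> i\<close> is the preimage of some \<open>A\<close>
    with \<open>submetric Y A\<close> in \<open>\<V> i\<close>, so the pullback lemma applies with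
    \<open>A\<close> as its \<open>B\<close>.\<close>
  moreover have "family_decomposes_over (?\<W> i) (R (Suc i)) (s (L * R (Suc i) + C)) (?\<W> (Suc i))"
    if "i \<in> {1..<n}" for i
    using step[OF that] decomposes_over_pullback[OF f \<open>0 < L\<close> upper]
    unfolding family_decomposes_over_def pullback_family_def[of X Y f "\<V> i"] by blast
  moreover have "uniformly_bounded (?\<W> n)"
    by (rule uniformly_bounded_pullback[OF f \<open>0 < L\<close> lower bdd])
  ultimately show "\<exists>n\<ge>1. \<exists>\<W>. decomposes_over X (R 1) (s (L * R 1 + C)) (\<W> 1) \<and>
      (\<forall>i\<in>{1..<n}. family_decomposes_over (\<W> i) (R (Suc i)) (s (L * R (Suc i) + C)) (\<W> (Suc i))) \<and>
      uniformly_bounded (\<W> n)"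
    using n by (intro exI[of _ n] exI[of _ ?\<W>] conjI) auto
qed

section \<open>Growth under affine change of argument\<close>

lemma same_growth_affine:
  assumes s: "mono_on {0<..} s" and LC: "0 < L" "0 < C"
  shows "same_growth s (\<lambda>x. s (L * x + C))"
proof -
  have mono: "s x \<le> s y" if "0 < x" "x \<le> y" for x y
    using s that by (auto simp: mono_on_def)
  \<comment> \<open>The summand \<open>L + C\<close> gives \<open>L * x + C \<le> a * x\<close> for
    \<open>x \<ge> 1\<close>, and \<open>1 / L\<close> gives \<open>1 \<le> L * a\<close> for the
    reverse comparison. For \<open>x < 1\<close> the constant \<open>s (L + C)\<close> absorbs the
    value.\<close>
  define a where "a = L + C + 1 / L"
  have a: "0 < a" "L + C \<le> a" "1 \<le> L * a"
    using LC by (auto simp: a_def distrib_left add_pos_pos)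
  have "s (L * x + C) \<le> s (a * x) + s (L + C)" if "0 < x" for x
  proof (cases "1 \<le> x")
    case True
    have "L * x + C * 1 \<le> (L + C) * x"
      using True LC by (simp add: algebra_simps)
    also have "\<dots> \<le> a * x"
      using a that by (intro mult_right_mono) auto
    finally show ?thesis
      using mono[of "L * x + C" "a * x"] LC that by (simp add: add_pos_pos)
  next
    case False
    then show ?thesis
      using mono[of "L * x + C" "L + C"] LC that by (simp add: add_pos_pos)
  qed
  moreover have "s x \<le> s (L * (a * x) + C)" if "0 < x" for x
  proof (rule mono[OF that])
    have "1 * x \<le> (L * a) * x"
      using a that by (intro mult_right_mono) auto
    then show "x \<le> L * (a * x) + C"
      using LC by (simp add: mult.assoc)
  qed
  ultimately show ?thesis
    unfolding same_growth_def using a(1)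
    \<comment> \<open>Adding 1 keeps the additive constant positive even if
      \<open>s (L + C) = 0\<close>.\<close>
    by (intro exI[of _ a] exI[of _ "real (s (L + C)) + 1"]) force
qed

lemma same_growth_commute: "same_growth s t \<longleftrightarrow> same_growth t s"
  unfolding same_growth_def by (simp add: conj_commute)

section \<open>Quasi-isometric embeddings and quasi-inverses\<close>

lemma dc_growth_function_qi_embedding:
  assumes "qi_embedding X Y f" "dc_growth_function Y s"
  shows "\<exists>t. same_growth s t \<and> dc_growth_function X t"
proof -
  obtain L C where "f \<in> mspace X \<rightarrow> mspace Y" and LC: "0 < L" "0 < C"
    and "\<And>x y. x \<in> mspace X \<Longrightarrow> y \<in> mspace X \<Longrightarrow> 1 / L * mdist X x y - C < mdist Y (f x) (f y)"
    and "\<And>x y. x \<in> mspace X \<Longrightarrow> y \<in> mspace X \<Longrightarrow> mdist Y (f x) (f y) < L * mdist X x y + C"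
    using assms(1) unfolding qi_embedding_def by blast
  then have "dc_growth_function X (\<lambda>x. s (L * x + C))"
    using assms(2) by (intro dc_growth_function_pullback[where f = f and Y = Y]) (auto intro: less_imp_le)
  moreover have "same_growth s (\<lambda>x. s (L * x + C))"
    using assms(2) LC by (intro same_growth_affine) (auto simp: dc_growth_function_def)
  ultimately show ?thesis by blast
qed

text \<open>Let \<open>g\<close> choose for each \<open>y\<close> a point whose image is within
  \<open>K\<close> of \<open>y\<close>. Replacing \<open>y\<close>, \<open>z\<close> by
  \<open>f (g y)\<close>, \<open>f (g z)\<close> changes their distance by less than
  \<open>2 * K\<close>, and the bounds for \<open>f\<close> can then be solved for
  \<open>mdist X (g y) (g z)\<close>.\<close>

lemma quasi_isometry_quasi_inverse:
  assumes "quasi_isometry X Y f"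
  shows "\<exists>g. qi_embedding Y X g"
proof -
  obtain L C where f: "f \<in> mspace X \<rightarrow> mspace Y" and LC: "0 < L" "0 < C"
    and lower: "\<And>x y. x \<in> mspace X \<Longrightarrow> y \<in> mspace X \<Longrightarrow> 1 / L * mdist X x y - C < mdist Y (f x) (f y)"
    and upper: "\<And>x y. x \<in> mspace X \<Longrightarrow> y \<in> mspace X \<Longrightarrow> mdist Y (f x) (f y) < L * mdist X x y + C"
    using assms unfolding quasi_isometry_def qi_embedding_def by blast
  obtain K where "0 < K" and K: "\<forall>y\<in>mspace Y. \<exists>x\<in>mspace X. mdist Y y (f x) < K"
    using assms unfolding quasi_isometry_def by blast
  from K obtain g where g: "\<And>y. y \<in> mspace Y \<Longrightarrow> g y \<in> mspace X"
    and near: "\<And>y. y \<in> mspace Y \<Longrightarrow> mdist Y y (f (g y)) < K"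
    by metis
  \<comment> \<open>Solving the lower bound for \<open>f\<close> leaves the error
    \<open>L * (C + 2 * K)\<close>, solving the upper bound leaves \<open>(C + 2 * K) / L\<close>;
    their sum covers both, with \<open>L\<close> unchanged.\<close>
  define C' where "C' = L * (C + 2 * K) + (C + 2 * K) / L"
  have pos: "0 < L * (C + 2 * K)" "0 < (C + 2 * K) / L"
    using LC \<open>0 < K\<close> by (auto simp: add_pos_pos)
  have "1 / L * mdist Y y z - C' < mdist X (g y) (g z) \<and> mdist X (g y) (g z) < L * mdist Y y z + C'"
    if yz: "y \<in> mspace Y" "z \<in> mspace Y" for y z
  proof -
    have fg: "f (g y) \<in> mspace Y" "f (g z) \<in> mspace Y"
      using f g yz by auto
    have "mdist Y y z \<le> mdist Y y (f (g y)) + mdist Y (f (g y)) (f (g z)) + mdist Y z (f (g z))"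
      using mdist_triangle[of y Y "f (g y)" z] mdist_triangle[of "f (g y)" Y "f (g z)" z] fg yz
        mdist_commute[of Y "f (g z)" z] by linarith
    then have "mdist Y y z < L * mdist X (g y) (g z) + (C + 2 * K)"
      using near[OF yz(1)] near[OF yz(2)] upper[of "g y" "g z"] g yz by fastforce
    then have 1: "1 / L * mdist Y y z < mdist X (g y) (g z) + (C + 2 * K) / L"
      using LC by (simp add: field_simps)
    have "mdist Y (f (g y)) (f (g z)) \<le> mdist Y y (f (g y)) + mdist Y y z + mdist Y z (f (g z))"
      using mdist_triangle[of "f (g y)" Y y "f (g z)"] mdist_triangle[of y Y z "f (g z)"] fg yz
        mdist_commute[of Y "f (g y)" y] by linarith
    then have "1 / L * mdist X (g y) (g z) < mdist Y y z + (C + 2 * K)"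
      using near[OF yz(1)] near[OF yz(2)] lower[of "g y" "g z"] g yz by fastforce
    then have 2: "mdist X (g y) (g z) < L * mdist Y y z + L * (C + 2 * K)"
      using LC by (simp add: field_simps)
    show ?thesis
      using 1 2 pos unfolding C'_def by linarith
  qed
  moreover have "0 < C'"
    using pos by (simp add: C'_def)
  ultimately have "qi_embedding Y X g"
    using g LC(1) unfolding qi_embedding_def by blast
  then show ?thesis by blast
qed

theorem theorem3p1:
  fixes X :: "'a metric" and Y :: "'b metric"
  shows "(\<forall>f s. qi_embedding X Y f \<and> dc_growth_function Y s \<longrightarrow>
            (\<exists>t. same_growth s t \<and> dc_growth_function X t)) \<and>
         (quasi_isometric X Y \<longrightarrow>
            (\<forall>s. dc_growth_function X s \<longrightarrow> (\<exists>t. dc_growth_function Y t \<and> same_growth t s)) \<and>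
            (\<forall>s. dc_growth_function Y s \<longrightarrow> (\<exists>t. dc_growth_function X t \<and> same_growth t s)))"
proof (intro conjI impI)
  show "\<forall>f s. qi_embedding X Y f \<and> dc_growth_function Y s \<longrightarrow>
      (\<exists>t. same_growth s t \<and> dc_growth_function X t)"
    using dc_growth_function_qi_embedding by blast
next
  assume "quasi_isometric X Y"
  \<comment> \<open>Growth functions are pulled back against the direction of a map, so passing from
    \<open>X\<close> to \<open>Y\<close> takes an embedding of \<open>Y\<close> into
    \<open>X\<close>.\<close>
  then obtain g where "qi_embedding Y X g"
    unfolding quasi_isometric_def using quasi_isometry_quasi_inverse by blast
  then show "\<forall>s. dc_growth_function X s \<longrightarrow> (\<exists>t. dc_growth_function Y t \<and> same_growth t s)"
    using dc_growth_function_qi_embedding same_growth_commute by blast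
next
  assume "quasi_isometric X Y"
  then obtain f where "qi_embedding X Y f"
    unfolding quasi_isometric_def quasi_isometry_def by blast
  then show "\<forall>s. dc_growth_function Y s \<longrightarrow> (\<exists>t. dc_growth_function X t \<and> same_growth t s)"
    using dc_growth_function_qi_embedding same_growth_commute by blast
qed

end
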